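(* Let $D$ denote the kite. For every $v\equiv 0,1\pmod 8$ with $v>1$, \[\mathcal{L}_1D(v)=\{n\geq v-1\mid n\equiv 0,1\pmod 4\},\] \[\mathcal{L}_2D(v)=\{n\geq v\mid n\equiv 0,1\pmod 4\}.\]
   Context: All graphs are finite and simple; $\Gamma\leq K$ means $\Gamma$ is a subgraph of $K$ (or is isomorphic to one, when $\Gamma$ is an abstract graph). $P_3$ is the path on $3$ vertices. The kite $D$ is a triangle with an attached edge: the graph with vertices $a,b,c,d$ and edges $ca,cb,cd,ab$. For a graph $K$ and $\Gamma\leq K$, a $(K,\Gamma)$-design is a set $\mathcal{B}$ of subgraphs of $K$, called blocks, each isomorphic to $\Gamma$, whose edge-sets partition $E(K)$. $K_n$ is the complete graph on a set of $n$ vertices (any $n$-element vertex set may be used); a $\Gamma$-design of order $n$ is a $(K_n,\Gamma)$-design. Given $\Gamma'\leq\Gamma$, a $(K,\Gamma)$-design $\mathcal{B}$ and a $(K',\Gamma')$-design $\mathcal{B}'$, a down-link from $\mathcal{B}$ to $\mathcal{B}'$ is a function $f:\mathcal{B}\to\mathcal{B}'$ such that $f(B)$ is a subgraph of $B$ for every $B\in\mathcal{B}$ (the vertex sets of $K$ and $K'$ need not coincide, and either may be the larger). Take $\Gamma'=P_3$. For $v$ such that a $(K_v,\Gamma)$-design exists: $\mathcal{L}_1\Gamma(v)$ is the set of all integers $n$ such that some $\Gamma$-design of order $v$ can be down-linked to a $P_3$-design of order $n$; $\mathcal{L}_2\Gamma(v)$ is the set of all integers $n$ such that every $\Gamma$-design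 of order $v$ can be down-linked to a $P_3$-design of order $n$. A $(K_v,D)$-design exists if and only if $v\equiv 0,1\pmod 8$, $v>1$. *)

theory Defs
  imports "HOL-Library.Disjoint_Sets" "HOL-Library.FuncSet" "HOL-Library.Infinite_Typeclass"
    "HOL-Number_Theory.Cong"
begin

datatype 'a graph = Graph (verts: "'a set") (edges: "'a set set")

definition simple_graph :: "'a graph \<Rightarrow> bool" where
  "simple_graph G \<longleftrightarrow> finite (verts G) \<and> (\<forall>e \<in> edges G. e \<subseteq> verts G \<and> card e = 2)"

definition subgraph :: "'a graph \<Rightarrow> 'a graph \<Rightarrow> bool" where
  "subgraph H G \<longleftrightarrow>
     simple_graph H \<and> simple_graph G \<and> verts H \<subseteq> verts G \<and> edges H \<subseteq> edges G"

definition graph_isomorphic :: "'a graph \<Rightarrow> 'b graph \<Rightarrow> bool" where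
  "graph_isomorphic G H \<longleftrightarrow>
     (\<exists>\<phi>. bij_betw \<phi> (verts G) (verts H) \<and> edges H = (\<lambda>e. \<phi> ` e) ` edges G)"

definition complete_graph :: "'a set \<Rightarrow> 'a graph" where
  "complete_graph V = Graph V {e. e \<subseteq> V \<and> card e = 2}"

definition path3 :: "nat graph" where
  "path3 = Graph {0, 1, 2} {{0, 1}, {1, 2}}"

text \<open>The vertices \<open>a, b, c, d\<close> of the kite, with edges \<open>ca, cb, cd, ab\<close>, are
  \<open>0, 1, 2, 3\<close> in this order.\<close>

definition kite :: "nat graph" where
  "kite = Graph {0, 1, 2, 3} {{2, 0}, {2, 1}, {2, 3}, {0, 1}}"

text \<open>Disjointness is required of the indexed family of edge sets, so that distinct blocks
  can never share an edge set.\<close>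

definition design :: "'a graph \<Rightarrow> 'b graph \<Rightarrow> 'a graph set \<Rightarrow> bool" where
  "design K \<Gamma> \<B> \<longleftrightarrow>
     (\<forall>B \<in> \<B>. subgraph B K \<and> graph_isomorphic B \<Gamma>) \<and>
     disjoint_family_on edges \<B> \<and> (\<Union>B \<in> \<B>. edges B) = edges K"

definition design_of_order :: "nat \<Rightarrow> 'b graph \<Rightarrow> 'a graph set \<Rightarrow> bool" where
  "design_of_order n \<Gamma> \<B> \<longleftrightarrow>
     (\<exists>V. finite V \<and> card V = n \<and> design (complete_graph V) \<Gamma> \<B>)"

definition down_link :: "('a graph \<Rightarrow> 'a graph) \<Rightarrow> 'a graph set \<Rightarrow> 'a graph set \<Rightarrow> bool" where
  "down_link f \<B> \<B>' \<longleftrightarrow> f \<in> \<B> \<rightarrow> \<B>' \<and> (\<forall>B \<in> \<B>. subgraph (f B) B)"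

definition down_linkable :: "'a graph set \<Rightarrow> 'a graph set \<Rightarrow> bool" where
  "down_linkable \<B> \<B>' \<longleftrightarrow> (\<exists>f. down_link f \<B> \<B>')"

text \<open>The two sets below are the order spectra of down-links into \<open>P\<^sub>3\<close>-designs. The vertices of
  both designs are drawn from an arbitrary infinite type \<open>'a\<close>, so vertex sets of every finite size,
  overlapping in any way, are available for either design; the type has to be an argument because
  it does not occur in the result.\<close>

definition L1 :: "'a::infinite itself \<Rightarrow> 'b graph \<Rightarrow> nat \<Rightarrow> nat set" where
  "L1 T \<Gamma> v = {n. \<exists>\<B> :: 'a graph set. design_of_order v \<Gamma> \<B> \<and>
                   (\<exists>\<B>'. design_of_order n path3 \<B>' \<and> down_linkable \<B> \<B>')}"

definition L2 :: "'a::infinite itself \<Rightarrow> 'b graph \<Rightarrow> nat \<Rightarrow> nat set" where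
  "L2 T \<Gamma> v = {n. \<forall>\<B> :: 'a graph set. design_of_order v \<Gamma> \<B> \<longrightarrow>
                   (\<exists>\<B>'. design_of_order n path3 \<B>' \<and> down_linkable \<B> \<B>')}"

end

theory Submission
  imports Defs
begin

text \<open>Two vertices outside \<open>V'\<close> would lie in a common block, which then has no path on three vertices
  inside \<open>V'\<close>; so \<open>n \<ge> v - 1\<close>, and if \<open>n = v - 1\<close> the missing vertex is the centre of no kite.
  In the cyclic kite design of order \<open>8t + 1\<close> every vertex is a centre, which excludes \<open>v - 1\<close>
  from the second spectrum. Conversely a kite is a union of two paths, so every kite design of
  order \<open>v\<close> refines to a path design of order \<open>v\<close>, and the edges of \<open>K\<^sub>n\<close> outside
  \<open>K\<^sub>v\<close> form a connected graph with an even number of edges, which splits into paths. For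
  \<open>n = v - 1\<close> the cyclic design is modified so that one vertex is no longer a centre.\<close>

section \<open>Edge sets of complete graphs and kites\<close>

text \<open>The order \<open>v - 1\<close> is in question only for v = 8t + 1, because 8t - 1 is 3
  modulo 4. The obstacle there is a kite whose pendant vertex is deleted: it becomes a triangle,
  which has an odd number of edges, so one edge has to be given up. The edges given up must then be
  decomposable among themselves. For this it suffices that one vertex is adjacent, within this set,
  to an endpoint of every edge avoiding it; the parity is automatic, since an even total minus a
  union of paths is even. The same argument covers orders from \<open>v\<close> on, with the edges
  outside K_v in place of those given up. The vertex to be deleted is made a non-centre by
  redistributing pendant edges only: all triangles stay as in the cyclic design, so its count of
  differences can be reused.\<close>

definition all_edges :: "'a set \<Rightarrow> 'a set set" where
  "all_edges V = {e. e \<subseteq> V \<and> card e = 2}"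

lemma complete_graph_simps [simp]:
  "verts (complete_graph V) = V" "edges (complete_graph V) = all_edges V"
  by (simp_all add: complete_graph_def all_edges_def)

lemma simple_complete_graph: "finite V \<Longrightarrow> simple_graph (complete_graph V)"
  by (auto simp: simple_graph_def all_edges_def)

lemma pair_in_all_edges [simp]: "{x, y} \<in> all_edges V \<longleftrightarrow> x \<in> V \<and> y \<in> V \<and> x \<noteq> y"
  by (auto simp: all_edges_def card_insert_if)

lemma all_edgesE:
  assumes "e \<in> all_edges V"
  obtains x y where "e = {x, y}" "x \<noteq> y" "x \<in> V" "y \<in> V"
  using assms by (auto simp: all_edges_def card_2_iff)

lemma card_all_edges: "finite V \<Longrightarrow> card (all_edges V) = card V choose 2"
  by (simp add: all_edges_def n_subsets)

lemma finite_all_edges: "finite V \<Longrightarrow> finite (all_edges V)"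
  by (simp add: all_edges_def)

text \<open>K_n has \<open>n choose 2\<close> edges, which paths use up in pairs; this is the source
  of the condition modulo 4 in both spectra.\<close>

lemma even_choose_2_iff: "even (n choose 2) \<longleftrightarrow> [n = 0] (mod 4) \<or> [n = 1] (mod 4)"
proof -
  obtain q r where n: "n = 4 * q + r" "r < 4"
    by (metis div_mult_mod_eq mod_less_divisor mult.commute zero_less_numeral)
  have m: "n mod 4 = r" using n by simp
  have "r = 0 \<or> r = 1 \<or> r = 2 \<or> r = 3" using n(2) by linarith
  then show ?thesis
  proof (elim disjE)
    assume "r = 0"
    with n(1) have "n choose 2 = 2 * (q * (4 * q - 1))" by (simp add: choose_two)
    with m \<open>r = 0\<close> show ?thesis by (simp add: cong_def)
  next
    assume "r = 1"
    with n(1) have "n choose 2 = 2 * (q * (4 * q + 1))" by (simp add: choose_two)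
    with m \<open>r = 1\<close> show ?thesis by (simp add: cong_def)
  next
    assume "r = 2"
    with n(1) have "n * (n - 1) = 2 * (2 * (q * (4 * q + 3)) + 1)" by (simp add: algebra_simps)
    then have "n choose 2 = 2 * (q * (4 * q + 3)) + 1" by (simp add: choose_two)
    with m \<open>r = 2\<close> show ?thesis by (simp add: cong_def)
  next
    assume "r = 3"
    with n(1) have "n * (n - 1) = 2 * (2 * (q * (4 * q + 5) + 1) + 1)" by (simp add: algebra_simps)
    then have "n choose 2 = 2 * (q * (4 * q + 5) + 1) + 1" by (simp add: choose_two)
    with m \<open>r = 3\<close> show ?thesis by (simp add: cong_def)
  qed
qed

lemma card_isomorphic:
  assumes "graph_isomorphic G H" "simple_graph G"
  shows "card (verts G) = card (verts H)" "card (edges G) = card (edges H)"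
proof -
  obtain \<phi> where \<phi>: "bij_betw \<phi> (verts G) (verts H)" "edges H = (`) \<phi> ` edges G"
    using assms by (auto simp: graph_isomorphic_def)
  show "card (verts G) = card (verts H)" using \<phi>(1) by (rule bij_betw_same_card)
  have "inj_on ((`) \<phi>) (Pow (verts G))"
    using \<phi>(1) by (simp add: bij_betw_def inj_on_image_Pow)
  then have "inj_on ((`) \<phi>) (edges G)"
    by (rule inj_on_subset) (use assms in \<open>auto simp: simple_graph_def\<close>)
  then show "card (edges G) = card (edges H)" using \<phi>(2) by (simp add: card_image)
qed

text \<open>The argument order is that of the vertices 0, 1, 2, 3 of \<open>kite\<close>:
  \<open>c\<close> is the vertex of degree 3, called the centre, \<open>d\<close> is the pendant
  vertex, and \<open>{a, b}\<close> is the side of the triangle opposite the centre.\<close>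

definition kite_graph :: "'a \<Rightarrow> 'a \<Rightarrow> 'a \<Rightarrow> 'a \<Rightarrow> 'a graph" where
  "kite_graph a b c d = Graph {a, b, c, d} {{c, a}, {c, b}, {c, d}, {a, b}}"

lemma kite_graph_simps [simp]:
  "verts (kite_graph a b c d) = {a, b, c, d}"
  "edges (kite_graph a b c d) = {{c, a}, {c, b}, {c, d}, {a, b}}"
  by (simp_all add: kite_graph_def)

lemma kite_graph_isomorphic:
  assumes "distinct [a, b, c, d]"
  shows "graph_isomorphic (kite_graph a b c d) kite"
  unfolding graph_isomorphic_def
proof (intro exI conjI)
  define \<phi> :: "'a \<Rightarrow> nat"
    where "\<phi> y = (if y = a then 0 else if y = b then 1 else if y = c then 2 else 3)" for y
  have \<phi>: "\<phi> a = 0" "\<phi> b = 1" "\<phi> c = 2" "\<phi> d = 3"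
    using assms by (auto simp: \<phi>_def)
  show "bij_betw \<phi> (verts (kite_graph a b c d)) (verts kite)"
    using assms \<phi> by (auto simp: bij_betw_def inj_on_def kite_def)
  show "edges kite = (`) \<phi> ` edges (kite_graph a b c d)"
    using \<phi> by (simp add: kite_def)
qed

lemma isomorphic_kiteE:
  assumes "graph_isomorphic B kite" "simple_graph B"
  obtains a b c d where "distinct [a, b, c, d]" "B = kite_graph a b c d"
proof -
  obtain \<phi> where \<phi>: "bij_betw \<phi> (verts B) (verts kite)" "edges kite = (`) \<phi> ` edges B"
    using assms by (auto simp: graph_isomorphic_def)
  define \<psi> where "\<psi> = inv_into (verts B) \<phi>"
  have \<psi>: "bij_betw \<psi> (verts kite) (verts B)"
    using \<phi>(1) by (simp add: \<psi>_def bij_betw_inv_into)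
  have "\<psi> ` \<phi> ` e = e" if "e \<in> edges B" for e
  proof -
    have "e \<subseteq> verts B" using that assms by (auto simp: simple_graph_def)
    then show ?thesis
      using \<phi>(1) unfolding \<psi>_def bij_betw_def by (simp add: inv_into_image_cancel)
  qed
  then have "(`) \<psi> ` edges kite = edges B" by (simp add: \<phi>(2) image_image)
  then have e: "edges B = {{\<psi> 2, \<psi> 0}, {\<psi> 2, \<psi> 1}, {\<psi> 2, \<psi> 3}, {\<psi> 0, \<psi> 1}}"
    by (auto simp: kite_def)
  have v: "verts B = {\<psi> 0, \<psi> 1, \<psi> 2, \<psi> 3}"
    using \<psi> by (auto simp: bij_betw_def kite_def)
  have "distinct [\<psi> 0, \<psi> 1, \<psi> 2, \<psi> 3]"
    using \<psi> by (auto simp: bij_betw_def kite_def inj_on_def)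
  moreover have "B = kite_graph (\<psi> 0) (\<psi> 1) (\<psi> 2) (\<psi> 3)"
    using e v by (cases B) (simp add: kite_graph_def)
  ultimately show thesis by (rule that)
qed

lemma design_kite_block:
  assumes "design (complete_graph V) kite \<B>" "B \<in> \<B>"
  obtains a b c d where "distinct [a, b, c, d]" "{a, b, c, d} \<subseteq> V" "B = kite_graph a b c d"
proof -
  have B: "graph_isomorphic B kite" "simple_graph B" "verts B \<subseteq> V"
    using assms by (auto simp: design_def subgraph_def)
  obtain a b c d where "distinct [a, b, c, d]" "B = kite_graph a b c d"
    using isomorphic_kiteE[OF B(1,2)] .
  with B(3) show thesis by (intro that[of a b c d]) auto
qed

lemma card_edges_kite_graph:
  assumes "distinct [a, b, c, d]"
  shows "card (edges (kite_graph a b c d)) = 4"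
  using assms by (auto simp: card_insert_if doubleton_eq_iff)

text \<open>Disjointness of the blocks comes from counting: they cover all edges, and there are not
  enough of them for an edge to be covered twice.\<close>

lemma kite_family_design:
  assumes V: "finite V" and I: "finite I"
    and kite: "\<And>i. i \<in> I \<Longrightarrow> \<exists>a b c d. distinct [a, b, c, d] \<and> {a, b, c, d} \<subseteq> V \<and> K i = kite_graph a b c d"
    and cover: "\<And>e. e \<in> all_edges V \<Longrightarrow> \<exists>i \<in> I. e \<in> edges (K i)"
    and count: "4 * card I \<le> card V choose 2"
  shows "disjoint_family_on (\<lambda>i. edges (K i)) I" "design (complete_graph V) kite (K ` I)"
proof -
  have c4: "card (edges (K i)) = 4" if "i \<in> I" for i
    using kite[OF that] card_edges_kite_graph by metis
  have sub: "edges (K i) \<subseteq> all_edges V" if "i \<in> I" for i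
    using kite[OF that] by auto
  have un: "(\<Union>i \<in> I. edges (K i)) = all_edges V"
    using cover sub by blast
  show disj: "disjoint_family_on (\<lambda>i. edges (K i)) I"
    unfolding disjoint_family_on_def
  proof (intro ballI impI, rule ccontr)
    fix i j assume ij: "i \<in> I" "j \<in> I" "i \<noteq> j" "edges (K i) \<inter> edges (K j) \<noteq> {}"
    then obtain e where e: "e \<in> edges (K i)" "e \<in> edges (K j)" by blast
    have fj: "finite (edges (K j))" using c4[OF ij(2)] by (metis card.infinite zero_neq_numeral)
    have "all_edges V \<subseteq> (\<Union>l \<in> I - {j}. edges (K l)) \<union> (edges (K j) - {e})"
      using un e ij by blast
    moreover have "finite ((\<Union>l \<in> I - {j}. edges (K l)) \<union> (edges (K j) - {e}))"
      by (rule finite_subset[OF _ finite_all_edges[OF V]]) (use sub ij in blast)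
    ultimately have "card (all_edges V) \<le> card ((\<Union>l \<in> I - {j}. edges (K l)) \<union> (edges (K j) - {e}))"
      by (intro card_mono)
    also have "\<dots> \<le> card (\<Union>l \<in> I - {j}. edges (K l)) + card (edges (K j) - {e})"
      by (rule card_Un_le)
    also have "card (\<Union>l \<in> I - {j}. edges (K l)) \<le> (\<Sum>l \<in> I - {j}. card (edges (K l)))"
      using I by (intro card_UN_le) auto
    also have "(\<Sum>l \<in> I - {j}. card (edges (K l))) = (\<Sum>l \<in> I - {j}. 4)"
      by (rule sum.cong) (auto simp: c4)
    also have "\<dots> = 4 * (card I - 1)" using ij I by simp
    also have "card (edges (K j) - {e}) = 3" using c4[OF ij(2)] e fj by simp
    finally have "card V choose 2 \<le> 4 * (card I - 1) + 3"
      using card_all_edges[OF V] by simp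
    moreover have "card I > 0" using ij I card_gt_0_iff by blast
    ultimately show False using count by linarith
  qed
  show "design (complete_graph V) kite (K ` I)"
    unfolding design_def
  proof (intro conjI ballI)
    fix B assume "B \<in> K ` I"
    then obtain i where i: "i \<in> I" "B = K i" by blast
    then obtain a b c d where k: "distinct [a, b, c, d]" "{a, b, c, d} \<subseteq> V" "B = kite_graph a b c d"
      using kite by metis
    show "graph_isomorphic B kite" using k kite_graph_isomorphic by metis
    show "subgraph B (complete_graph V)"
      using k V simple_complete_graph[OF V] by (auto simp: subgraph_def simple_graph_def)
  next
    show "disjoint_family_on edges (K ` I)"
      using disj unfolding disjoint_family_on_def by (metis imageE)
    show "(\<Union>B \<in> K ` I. edges B) = edges (complete_graph V)" using un by simp
  qed
qed

section \<open>Partitions of edge sets into paths on three vertices\<close>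

text \<open>A path is represented by its edge set alone, so that decompositions are partitions of
  sets of edges; the vertex set is recovered as \<open>\<Union>S\<close> once a design is
  built.\<close>

definition cherry :: "'a set set \<Rightarrow> bool" where
  "cherry S \<longleftrightarrow> (\<exists>a b c. distinct [a, b, c] \<and> S = {{a, b}, {b, c}})"

definition p3_partition :: "'a set set \<Rightarrow> 'a set set set \<Rightarrow> bool" where
  "p3_partition E Q \<longleftrightarrow> disjoint Q \<and> \<Union>Q = E \<and> (\<forall>S \<in> Q. cherry S)"

lemma cherryI: "distinct [a, b, c] \<Longrightarrow> cherry {{a, b}, {b, c}}"
  by (auto simp: cherry_def)

lemma card_cherry: "cherry S \<Longrightarrow> card S = 2"
  by (auto simp: cherry_def card_insert_if doubleton_eq_iff)

lemma p3_partition_empty [simp]: "p3_partition {} {}"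
  by (simp add: p3_partition_def)

lemma p3_partition_singleton: "cherry S \<Longrightarrow> p3_partition S {S}"
  by (simp add: p3_partition_def)

lemma p3_partition_Un:
  assumes "p3_partition E Q" "p3_partition F R" "E \<inter> F = {}"
  shows "p3_partition (E \<union> F) (Q \<union> R)"
  using assms unfolding p3_partition_def by (auto intro!: disjoint_union)

lemma p3_partition_UN:
  assumes "disjoint_family_on E I" "\<And>i. i \<in> I \<Longrightarrow> p3_partition (E i) (Q i)"
  shows "p3_partition (\<Union>i \<in> I. E i) (\<Union>i \<in> I. Q i)"
proof -
  have "S \<inter> T = {}" if "S \<in> Q i" "T \<in> Q j" "S \<noteq> T" "i \<in> I" "j \<in> I" for S T i j
  proof (cases "i = j")
    case True
    then show ?thesis using that assms(2)[of i] by (auto simp: p3_partition_def disjoint_def)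
  next
    case False
    then have "E i \<inter> E j = {}" using assms(1) that by (auto simp: disjoint_family_on_def)
    moreover have "S \<subseteq> E i" "T \<subseteq> E j"
      using that assms(2)[of i] assms(2)[of j] by (auto simp: p3_partition_def)
    ultimately show ?thesis by blast
  qed
  then have "disjoint (\<Union>i \<in> I. Q i)" unfolding disjoint_def by blast
  moreover have "\<Union>(\<Union>i \<in> I. Q i) = (\<Union>i \<in> I. \<Union>(Q i))" by blast
  then have "\<Union>(\<Union>i \<in> I. Q i) = (\<Union>i \<in> I. E i)"
    using assms(2) by (simp add: p3_partition_def)
  moreover have "cherry S" if "S \<in> (\<Union>i \<in> I. Q i)" for S
    using that assms(2) by (auto simp: p3_partition_def)
  ultimately show ?thesis by (simp add: p3_partition_def)
qed

text \<open>This transfers the parity of the whole edge set to the edges that remain after a part of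
  it has been decomposed.\<close>

lemma p3_partition_even:
  assumes "p3_partition E Q"
  shows "even (card E)"
proof -
  have "card (\<Union>Q) = sum card Q"
  proof (rule card_Union_disjoint)
    show "pairwise disjnt Q"
      using assms by (auto simp: p3_partition_def disjoint_def pairwise_def disjnt_def)
    show "finite S" if "S \<in> Q" for S
      using that assms by (auto simp: p3_partition_def cherry_def)
  qed
  moreover have "even (sum card Q)"
    by (rule dvd_sum) (use assms in \<open>auto simp: p3_partition_def card_cherry\<close>)
  ultimately show ?thesis using assms by (simp add: p3_partition_def)
qed

text \<open>Two distinct edges at \<open>z\<close> always form a path with middle vertex
  \<open>z\<close>, so an even star may be paired off arbitrarily.\<close>

lemma p3_partition_star:
  assumes "finite S" "even (card S)" "\<And>e. e \<in> S \<Longrightarrow> z \<in> e \<and> card e = 2"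
  shows "\<exists>Q. p3_partition S Q"
  using assms
proof (induction "card S" arbitrary: S rule: less_induct)
  case less
  show ?case
  proof (cases "S = {}")
    case True
    then show ?thesis using p3_partition_empty by blast
  next
    case False
    then obtain e where e: "e \<in> S" by blast
    have "S \<noteq> {e}" using less.prems(2) by auto
    then obtain f where f: "f \<in> S" "f \<noteq> e" using e by blast
    obtain x where x: "e = {x, z}" "x \<noteq> z"
      using less.prems(3)[OF e] by (auto simp: card_2_iff)
    obtain y where y: "f = {z, y}" "y \<noteq> z"
      using less.prems(3)[OF f(1)] by (auto simp: card_2_iff)
    have "cherry {e, f}"
      unfolding x(1) y(1) by (rule cherryI) (use x y f in auto)
    then have ef: "p3_partition {e, f} {{e, f}}" by (rule p3_partition_singleton)
    have c: "card (S - {e, f}) = card S - 2"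
      using e f less.prems(1) by (simp add: card_Diff_subset)
    have "card S \<ge> 2"
      using card_mono[of S "{e, f}"] e f less.prems(1) by simp
    then have "\<exists>Q. p3_partition (S - {e, f}) Q"
      using less.hyps[of "S - {e, f}"] less.prems c by auto
    then obtain Q where "p3_partition (S - {e, f}) Q" ..
    from p3_partition_Un[OF ef this] have "p3_partition ({e, f} \<union> (S - {e, f})) ({{e, f}} \<union> Q)"
      by blast
    moreover have "{e, f} \<union> (S - {e, f}) = S" using e f by blast
    ultimately show ?thesis by auto
  qed
qed

text \<open>Each edge avoiding \<open>z\<close> is assigned to an endpoint adjacent to \<open>z\<close>; an endpoint \<open>x\<close> that
  receives an odd number of edges also takes \<open>{x, z}\<close>. All stars except possibly the one of the
  unused edges at \<open>z\<close> are then even, and that one is even because the total is.\<close>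

lemma p3_partition_dominated:
  assumes E: "finite E" "\<And>e. e \<in> E \<Longrightarrow> card e = 2" "even (card E)"
    and dom: "\<And>e. e \<in> E \<Longrightarrow> z \<notin> e \<Longrightarrow> \<exists>x \<in> e. {x, z} \<in> E"
  shows "\<exists>Q. p3_partition E Q"
proof -
  obtain g where g: "\<And>e. e \<in> E \<Longrightarrow> z \<notin> e \<Longrightarrow> g e \<in> e \<and> {g e, z} \<in> E"
    using dom by metis
  define A where "A x = {e \<in> E. z \<notin> e \<and> g e = x}" for x
  define F where "F x = A x \<union> (if odd (card (A x)) then {{x, z}} else {})" for x
  define X where "X = {x. A x \<noteq> {}}"
  have finA: "finite (A x)" for x using E(1) by (simp add: A_def)
  have X: "x \<noteq> z" "{x, z} \<in> E" if "x \<in> X" for x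
    using that g by (auto simp: X_def A_def)
  have FE: "F x \<subseteq> E" if "x \<in> X" for x
    using X(2)[OF that] by (auto simp: F_def A_def)
  have "\<exists>Q. p3_partition (F x) Q" if "x \<in> X" for x
  proof (rule p3_partition_star)
    show "finite (F x)" using finA by (simp add: F_def)
    have "{x, z} \<notin> A x" by (auto simp: A_def)
    then show "even (card (F x))" using finA by (simp add: F_def)
    show "x \<in> e \<and> card e = 2" if "e \<in> F x" for e
      using that FE[OF \<open>x \<in> X\<close>] E(2) g by (auto simp: F_def A_def split: if_splits)
  qed
  then obtain Q where Q: "\<And>x. x \<in> X \<Longrightarrow> p3_partition (F x) (Q x)" by metis
  \<comment> \<open>Edges in \<open>A x\<close> avoid \<open>z\<close> and have
    \<open>g e = x\<close>, whereas an added edge contains \<open>z\<close> and determines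
    \<open>x\<close>, as \<open>x \<noteq> z\<close>.\<close>
  have "disjoint_family_on F X"
    unfolding disjoint_family_on_def
    using X(1) by (auto simp: F_def A_def doubleton_eq_iff split: if_splits)
  from p3_partition_UN[OF this Q] have 1: "p3_partition (\<Union>x \<in> X. F x) (\<Union>x \<in> X. Q x)" .
  define R where "R = E - (\<Union>x \<in> X. F x)"
  have sub: "(\<Union>x \<in> X. F x) \<subseteq> E" using FE by blast
  have "\<exists>Q. p3_partition R Q"
  proof (rule p3_partition_star)
    show "finite R" using E(1) by (simp add: R_def)
    have "card R = card E - card (\<Union>x \<in> X. F x)"
      unfolding R_def using sub E(1) by (intro card_Diff_subset) (auto intro: finite_subset)
    then show "even (card R)" using E(3) p3_partition_even[OF 1] by simp
    \<comment> \<open>An edge \<open>e\<close> that avoids \<open>z\<close> belongs to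
      \<open>A (g e)\<close>, so what remains is a star at \<open>z\<close>.\<close>
    show "z \<in> e \<and> card e = 2" if "e \<in> R" for e
      using that E(2) by (auto simp: R_def X_def F_def A_def)
  qed
  then obtain P where "p3_partition R P" ..
  from p3_partition_Un[OF 1 this]
  have "p3_partition ((\<Union>x \<in> X. F x) \<union> R) ((\<Union>x \<in> X. Q x) \<union> P)"
    by (auto simp: R_def)
  moreover have "(\<Union>x \<in> X. F x) \<union> R = E" using sub by (auto simp: R_def)
  ultimately show ?thesis by auto
qed

section \<open>Passing between edge partitions and path designs\<close>

lemma path3_isomorphic:
  assumes "distinct [a, b, c]"
  shows "graph_isomorphic (Graph {a, b, c} {{a, b}, {b, c}}) path3"
  unfolding graph_isomorphic_def
proof (intro exI conjI)
  define \<phi> :: "'a \<Rightarrow> nat" where "\<phi> y = (if y = a then 0 else if y = b then 1 else 2)" for y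
  show "bij_betw \<phi> (verts (Graph {a, b, c} {{a, b}, {b, c}})) (verts path3)"
    using assms by (auto simp: bij_betw_def inj_on_def \<phi>_def path3_def)
  show "edges path3 = (`) \<phi> ` edges (Graph {a, b, c} {{a, b}, {b, c}})"
    using assms by (auto simp: \<phi>_def path3_def)
qed

lemma p3_partition_design:
  assumes V: "finite V" and Q: "p3_partition (all_edges V) Q"
  shows "design (complete_graph V) path3 ((\<lambda>S. Graph (\<Union>S) S) ` Q)"
  unfolding design_def
proof (intro conjI ballI)
  fix B assume "B \<in> (\<lambda>S. Graph (\<Union>S) S) ` Q"
  then obtain S where S: "S \<in> Q" "B = Graph (\<Union>S) S" by blast
  then obtain a b c where abc: "distinct [a, b, c]" "S = {{a, b}, {b, c}}"
    using Q by (auto simp: p3_partition_def cherry_def)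
  have sub: "S \<subseteq> all_edges V" using S Q by (auto simp: p3_partition_def)
  have "\<Union>S = {a, b, c}" using abc by auto
  then show "graph_isomorphic B path3" using path3_isomorphic[OF abc(1)] S abc by simp
  show "subgraph B (complete_graph V)"
    using sub S abc V simple_complete_graph[OF V] by (auto simp: subgraph_def simple_graph_def)
next
  show "disjoint_family_on edges ((\<lambda>S. Graph (\<Union>S) S) ` Q)"
    using Q by (auto simp: p3_partition_def disjoint_def disjoint_family_on_def)
  show "(\<Union>B \<in> (\<lambda>S. Graph (\<Union>S) S) ` Q. edges B) = edges (complete_graph V)"
    using Q by (auto simp: p3_partition_def)
qed

lemma design_path3_block:
  assumes "design (complete_graph V) path3 \<B>" "B \<in> \<B>"
  shows "verts B \<subseteq> V" "card (verts B) = 3" "card (edges B) = 2" "edges B \<subseteq> all_edges V"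
    "simple_graph B"
proof -
  have B: "graph_isomorphic B path3" "simple_graph B"
    using assms by (auto simp: design_def subgraph_def)
  have "card (verts path3) = 3" "card (edges path3) = 2"
    by (auto simp: path3_def card_insert_if doubleton_eq_iff)
  then show "card (verts B) = 3" "card (edges B) = 2" using card_isomorphic[OF B] by auto
  show "verts B \<subseteq> V" "edges B \<subseteq> all_edges V" "simple_graph B"
    using assms by (auto simp: design_def subgraph_def)
qed

lemma design_path3_order:
  assumes "design_of_order n path3 \<B>"
  shows "[n = 0] (mod 4) \<or> [n = 1] (mod 4)"
proof -
  obtain V where V: "finite V" "card V = n" "design (complete_graph V) path3 \<B>"
    using assms by (auto simp: design_of_order_def)
  have "finite (edges ` \<B>)"
    by (rule finite_subset[OF _ finite_Pow_iff[THEN iffD2, OF finite_all_edges[OF V(1)]]])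
      (use design_path3_block(4)[OF V(3)] in blast)
  have "card (\<Union>(edges ` \<B>)) = sum card (edges ` \<B>)"
  proof (rule card_Union_disjoint)
    show "pairwise disjnt (edges ` \<B>)"
      using V(3) unfolding design_def disjoint_family_on_def pairwise_def disjnt_def
      by (metis imageE)
    show "finite S" if "S \<in> edges ` \<B>" for S
      using that design_path3_block(4)[OF V(3)] finite_all_edges[OF V(1)] finite_subset by blast
  qed
  moreover have "even (sum card (edges ` \<B>))"
    by (rule dvd_sum) (use design_path3_block(3)[OF V(3)] in auto)
  moreover have "\<Union>(edges ` \<B>) = all_edges V" using V(3) by (simp add: design_def)
  ultimately have "even (n choose 2)" using card_all_edges[OF V(1)] V(2) by simp
  then show ?thesis by (simp add: even_choose_2_iff)
qed

section \<open>Down-links into path designs\<close>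

text \<open>A part contained in the edge set of a block spans a path that is a subgraph of that
  block, so choosing one such part per block defines the down-link.\<close>

lemma down_link_of_p3_partition:
  assumes \<B>: "design (complete_graph V) kite \<B>" and V': "finite V'"
    and Q: "p3_partition (all_edges V') Q"
    and S: "\<And>B. B \<in> \<B> \<Longrightarrow> \<exists>S \<in> Q. S \<subseteq> edges B"
  shows "\<exists>\<B>'. design_of_order (card V') path3 \<B>' \<and> down_linkable \<B> \<B>'"
proof -
  define \<B>' where "\<B>' = (\<lambda>S. Graph (\<Union>S) S) ` Q"
  have D: "design (complete_graph V') path3 \<B>'"
    unfolding \<B>'_def by (rule p3_partition_design[OF V' Q])
  obtain s where s: "\<And>B. B \<in> \<B> \<Longrightarrow> s B \<in> Q \<and> s B \<subseteq> edges B" using S by metis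
  have "down_link (\<lambda>B. Graph (\<Union>(s B)) (s B)) \<B> \<B>'"
    unfolding down_link_def
  proof (intro conjI ballI Pi_I)
    fix B assume B: "B \<in> \<B>"
    show in_\<B>': "Graph (\<Union>(s B)) (s B) \<in> \<B>'" using s[OF B] by (auto simp: \<B>'_def)
    have "simple_graph B" using \<B> B by (auto simp: design_def subgraph_def)
    moreover have "\<Union>(s B) \<subseteq> verts B"
      using s[OF B] \<open>simple_graph B\<close> unfolding simple_graph_def by blast
    ultimately show "subgraph (Graph (\<Union>(s B)) (s B)) B"
      using s[OF B] design_path3_block(5)[OF D in_\<B>'] by (simp add: subgraph_def)
  qed
  then show ?thesis using D V' unfolding design_of_order_def down_linkable_def by blast
qed

text \<open>\<open>L\<close> collects the edges that are not decomposed inside a block.\<close>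

lemma down_link_leftover:
  assumes \<B>: "design (complete_graph V) kite \<B>" and V': "finite V'" "even (card V' choose 2)"
    and L: "all_edges V' - all_edges V \<subseteq> L" "L \<subseteq> all_edges V'"
    and blocks: "\<And>B. B \<in> \<B> \<Longrightarrow> \<exists>Q. Q \<noteq> {} \<and> p3_partition (edges B \<inter> all_edges V' - L) Q"
    and dom: "\<And>e. e \<in> L \<Longrightarrow> z \<notin> e \<Longrightarrow> \<exists>x \<in> e. {x, z} \<in> L"
  shows "\<exists>\<B>'. design_of_order (card V') path3 \<B>' \<and> down_linkable \<B> \<B>'"
proof -
  define E where "E B = edges B \<inter> all_edges V' - L" for B
  obtain q where q: "\<And>B. B \<in> \<B> \<Longrightarrow> q B \<noteq> {} \<and> p3_partition (E B) (q B)"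
    using blocks unfolding E_def by metis
  have "disjoint_family_on E \<B>"
    using \<B> unfolding design_def disjoint_family_on_def E_def by blast
  then have 1: "p3_partition (\<Union>B \<in> \<B>. E B) (\<Union>B \<in> \<B>. q B)"
    by (rule p3_partition_UN) (use q in blast)
  have "(\<Union>B \<in> \<B>. edges B) = all_edges V" using \<B> by (simp add: design_def)
  then have un: "all_edges V' = (\<Union>B \<in> \<B>. E B) \<union> L" using L unfolding E_def by blast
  have dis: "(\<Union>B \<in> \<B>. E B) \<inter> L = {}" by (auto simp: E_def)
  have fin: "finite (all_edges V')" using V'(1) by (rule finite_all_edges)
  then have fin': "finite (\<Union>B \<in> \<B>. E B)" "finite L" unfolding un by auto
  have "card (\<Union>B \<in> \<B>. E B) + card L = card V' choose 2"
    using card_all_edges[OF V'(1)] card_Un_disjoint[OF fin' dis] unfolding un by simp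
  then have "even (card L)" using V'(2) p3_partition_even[OF 1] by (metis even_add)
  then obtain P where P: "p3_partition L P"
    using p3_partition_dominated[of L z] fin'(2) L(2) dom by (auto simp: all_edges_def)
  show ?thesis
  proof (rule down_link_of_p3_partition[OF \<B> V'(1)])
    show "p3_partition (all_edges V') ((\<Union>B \<in> \<B>. q B) \<union> P)"
      unfolding un by (rule p3_partition_Un[OF 1 P dis])
    fix B assume B: "B \<in> \<B>"
    then obtain S where S: "S \<in> q B" using q by blast
    then have "S \<subseteq> E B" using q[OF B] by (auto simp: p3_partition_def)
    then show "\<exists>S \<in> (\<Union>B \<in> \<B>. q B) \<union> P. S \<subseteq> edges B" using S B by (auto simp: E_def)
  qed
qed

text \<open>The kite splits into the paths a-b-c and a-c-d.\<close>

lemma p3_partition_kite: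
  assumes "distinct [a, b, c, d]"
  shows "\<exists>Q. Q \<noteq> {} \<and> p3_partition (edges (kite_graph a b c d)) Q"
proof -
  have "p3_partition ({{a, b}, {b, c}} \<union> {{a, c}, {c, d}}) ({{{a, b}, {b, c}}} \<union> {{{a, c}, {c, d}}})"
    by (intro p3_partition_Un p3_partition_singleton cherryI)
      (use assms in \<open>auto simp: doubleton_eq_iff\<close>)
  moreover have "{{a, b}, {b, c}} \<union> {{a, c}, {c, d}} = edges (kite_graph a b c d)"
    by (simp add: insert_commute)
  ultimately have "p3_partition (edges (kite_graph a b c d)) ({{{a, b}, {b, c}}} \<union> {{{a, c}, {c, d}}})"
    by metis
  then show ?thesis by blast
qed

text \<open>Deleting \<open>a\<close> or \<open>b\<close> leaves the path through \<open>c\<close>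
  to \<open>d\<close> and the other of the two. Deleting \<open>d\<close> leaves the triangle, and
  giving up any one of its sides leaves a path. Deleting \<open>c\<close> would leave only
  \<open>{a, b}\<close>, whence the assumption on \<open>z\<close>.\<close>

lemma p3_partition_kite_minus_vertex:
  assumes abcd: "distinct [a, b, c, d]" "{a, b, c, d} \<subseteq> V" and z: "z \<noteq> c"
    and L1: "d \<noteq> z \<Longrightarrow> edges (kite_graph a b c d) \<inter> L = {}"
    and L2: "d = z \<Longrightarrow> \<exists>e \<in> {{c, a}, {c, b}, {a, b}}. edges (kite_graph a b c d) \<inter> L = {e}"
  shows "\<exists>Q. Q \<noteq> {} \<and> p3_partition (edges (kite_graph a b c d) \<inter> all_edges (V - {z}) - L) Q"
proof -
  let ?K = "edges (kite_graph a b c d)"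
  let ?E = "?K \<inter> all_edges (V - {z}) - L"
  have cherry_case: ?thesis if "?E = {{x, y}, {y, w}}" "distinct [x, y, w]" for x y w
    using p3_partition_singleton[OF cherryI[OF that(2)]] unfolding that(1) by blast
  have mem: "{c, a} \<in> all_edges (V - {z}) \<longleftrightarrow> z \<noteq> a" "{c, b} \<in> all_edges (V - {z}) \<longleftrightarrow> z \<noteq> b"
    "{c, d} \<in> all_edges (V - {z}) \<longleftrightarrow> z \<noteq> d" "{a, b} \<in> all_edges (V - {z}) \<longleftrightarrow> z \<noteq> a \<and> z \<noteq> b"
    using abcd z by auto
  have K: "?K = {{c, a}, {c, b}, {c, d}, {a, b}}" by simp
  consider "z \<noteq> a" "z \<noteq> b" "z \<noteq> d" | "z = a" | "z = b" | "z = d" by blast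
  then show ?thesis
  proof cases
    case 1
    then have "?K \<inter> all_edges (V - {z}) = ?K" unfolding K using mem by blast
    then have "?E = ?K" using L1 1 by blast
    then show ?thesis using p3_partition_kite[OF abcd(1)] by simp
  next
    case 2
    then have m: "{c, a} \<notin> all_edges (V - {z})" "{c, b} \<in> all_edges (V - {z})"
      "{c, d} \<in> all_edges (V - {z})" "{a, b} \<notin> all_edges (V - {z})"
      using abcd by auto
    have "?K \<inter> all_edges (V - {z}) = {{c, b}, {c, d}}" unfolding K using m by blast
    moreover have "?K \<inter> L = {}" using 2 abcd(1) by (intro L1) auto
    ultimately have "?E = {{b, c}, {c, d}}" unfolding insert_commute[of b c] by blast
    then show ?thesis by (rule cherry_case) (use abcd in auto)
  next
    case 3
    then have m: "{c, a} \<in> all_edges (V - {z})" "{c, b} \<notin> all_edges (V - {z})"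
      "{c, d} \<in> all_edges (V - {z})" "{a, b} \<notin> all_edges (V - {z})"
      using abcd by auto
    have "?K \<inter> all_edges (V - {z}) = {{c, a}, {c, d}}" unfolding K using m by blast
    moreover have "?K \<inter> L = {}" using 3 abcd(1) by (intro L1) auto
    ultimately have "?E = {{a, c}, {c, d}}" unfolding insert_commute[of a c] by blast
    then show ?thesis by (rule cherry_case) (use abcd in auto)
  next
    case 4
    then have m: "{c, a} \<in> all_edges (V - {z})" "{c, b} \<in> all_edges (V - {z})"
      "{c, d} \<notin> all_edges (V - {z})" "{a, b} \<in> all_edges (V - {z})"
      using abcd by auto
    have tri: "?K \<inter> all_edges (V - {z}) = {{c, a}, {c, b}, {a, b}}" unfolding K using m by blast
    obtain e where e: "e \<in> {{c, a}, {c, b}, {a, b}}" "?K \<inter> L = {e}"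
      using L2 4 by blast
    have "A \<inter> B - L = T - {e}" if "A \<inter> B = T" "A \<inter> L = {e}" for A B T
      using that by blast
    from this[OF tri e(2)] have E: "?E = {{c, a}, {c, b}, {a, b}} - {e}" .
    have ne: "{c, a} \<noteq> {c, b}" "{c, a} \<noteq> {a, b}" "{c, b} \<noteq> {a, b}"
      using abcd(1) by (auto simp: doubleton_eq_iff)
    from e(1) consider "e = {c, a}" | "e = {c, b}" | "e = {a, b}" by blast
    then show ?thesis
    proof cases
      case 1
      have "?E = {{c, b}, {b, a}}"
        unfolding E 1 insert_commute[of b a] using ne by blast
      then show ?thesis by (rule cherry_case) (use abcd in auto)
    next
      case 2
      have "?E = {{c, a}, {a, b}}" unfolding E 2 using ne by blast
      then show ?thesis by (rule cherry_case) (use abcd in auto)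
    next
      case 3
      have "?E = {{a, c}, {c, b}}"
        unfolding E 3 insert_commute[of a c] using ne by blast
      then show ?thesis by (rule cherry_case) (use abcd in auto)
    qed
  qed
qed

lemma kite_design_down_link:
  fixes \<B> :: "'a::infinite graph set"
  assumes \<B>: "design_of_order v kite \<B>" and v: "v \<noteq> 0" "v \<le> n" and n: "even (n choose 2)"
  shows "\<exists>\<B>'. design_of_order n path3 \<B>' \<and> down_linkable \<B> \<B>'"
proof -
  obtain V where V: "finite V" "card V = v" "design (complete_graph V) kite \<B>"
    using \<B> by (auto simp: design_of_order_def)
  have "infinite (UNIV - V)" using V(1) infinite_UNIV by (rule Diff_infinite_finite)
  then obtain W where W: "finite W" "card W = n - v" "W \<subseteq> UNIV - V"
    using infinite_arbitrarily_large by blast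
  then have c: "card (V \<union> W) = n" using V v by (subst card_Un_disjoint) auto
  obtain z where z: "z \<in> V" using V v by fastforce
  define L where "L = all_edges (V \<union> W) - all_edges V"
  have "\<exists>\<B>'. design_of_order (card (V \<union> W)) path3 \<B>' \<and> down_linkable \<B> \<B>'"
  proof (rule down_link_leftover[OF V(3)])
    show "finite (V \<union> W)" using V W by simp
    show "even (card (V \<union> W) choose 2)" using n c by simp
    show "all_edges (V \<union> W) - all_edges V \<subseteq> L" "L \<subseteq> all_edges (V \<union> W)" by (auto simp: L_def)
    fix B assume "B \<in> \<B>"
    with V(3) obtain a b c d
      where k: "distinct [a, b, c, d]" "{a, b, c, d} \<subseteq> V" "B = kite_graph a b c d"
      by (rule design_kite_block)
    then have "edges B \<inter> all_edges (V \<union> W) - L = edges B" by (auto simp: L_def)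
    then show "\<exists>Q. Q \<noteq> {} \<and> p3_partition (edges B \<inter> all_edges (V \<union> W) - L) Q"
      using p3_partition_kite[OF k(1)] k(3) by simp
  next
    fix e assume e: "e \<in> L" "z \<notin> e"
    \<comment> \<open>Every edge of \<open>L\<close> has a new endpoint \<open>x\<close>; as
      \<open>z\<close> is old, \<open>{x, z}\<close> is again in \<open>L\<close>. Thus any old
      vertex dominates the new edges.\<close>
    then obtain x where "x \<in> e" "x \<in> V \<union> W" "x \<notin> V" by (auto simp: L_def all_edges_def)
    then show "\<exists>x \<in> e. {x, z} \<in> L" using z by (auto simp: L_def)
  qed
  then show ?thesis unfolding c .
qed

section \<open>Necessary conditions for a down-link\<close>

lemma down_link_block:
  assumes \<B>: "design (complete_graph V) kite \<B>" and \<B>': "design (complete_graph V') path3 \<B>'"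
    and f: "down_link f \<B> \<B>'" and B: "B \<in> \<B>"
  shows "verts (f B) \<subseteq> verts B \<inter> V'" "card (verts (f B)) = 3"
    "edges (f B) \<subseteq> edges B \<inter> all_edges V'" "card (edges (f B)) = 2"
proof -
  have fB: "f B \<in> \<B>'" "subgraph (f B) B" using f B by (auto simp: down_link_def)
  then show "verts (f B) \<subseteq> verts B \<inter> V'" "card (verts (f B)) = 3"
    "edges (f B) \<subseteq> edges B \<inter> all_edges V'" "card (edges (f B)) = 2"
    using design_path3_block[OF \<B>' fB(1)] by (auto simp: subgraph_def)
qed

lemma down_link_covers_all_but_one:
  assumes \<B>: "design (complete_graph V) kite \<B>" and \<B>': "design (complete_graph V') path3 \<B>'"
    and f: "down_link f \<B> \<B>'" and xy: "x \<in> V" "y \<in> V" "x \<noteq> y"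
  shows "x \<in> V' \<or> y \<in> V'"
proof (rule ccontr)
  assume neg: "\<not> (x \<in> V' \<or> y \<in> V')"
  have "{x, y} \<in> (\<Union>B \<in> \<B>. edges B)" using xy \<B> by (simp add: design_def)
  then obtain B where B: "B \<in> \<B>" "{x, y} \<in> edges B" by blast
  with \<B> obtain a b c d where k: "distinct [a, b, c, d]" "B = kite_graph a b c d"
    by (metis design_kite_block)
  have vB: "card (verts B) = 4" "finite (verts B)" using k by simp_all
  have "simple_graph B" using \<B> B(1) by (simp add: design_def subgraph_def)
  then have "{x, y} \<subseteq> verts B" using B(2) unfolding simple_graph_def by meson
  then have "card (verts B - {x, y}) = 2" using xy vB by (simp add: card_Diff_subset)
  moreover have "verts (f B) \<subseteq> verts B - {x, y}"
    using down_link_block(1)[OF \<B> \<B>' f B(1)] neg by blast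
  ultimately show False
    using card_mono[of "verts B - {x, y}" "verts (f B)"] down_link_block(2)[OF \<B> \<B>' f B(1)] vB
    by simp
qed

lemma down_link_order_ge:
  assumes \<B>: "design (complete_graph V) kite \<B>" and \<B>': "design (complete_graph V') path3 \<B>'"
    and f: "down_link f \<B> \<B>'" and fin: "finite V" "finite V'"
  shows "card V - 1 \<le> card V'"
proof -
  have "card (V - V') \<le> 1"
    using down_link_covers_all_but_one[OF \<B> \<B>' f] fin(1)
    by (auto simp: card_le_Suc0_iff_eq)
  moreover have "card V \<le> card (V - V') + card V'"
    using card_mono[of "(V - V') \<union> V'" V] card_Un_le[of "V - V'" V'] fin
    by fastforce
  ultimately show ?thesis by linarith
qed

text \<open>Three of the four edges meet the centre; without it only \<open>{a, b}\<close> is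
  available, and a path needs two edges.\<close>

lemma down_link_centre:
  assumes \<B>: "design (complete_graph V) kite \<B>" and \<B>': "design (complete_graph V') path3 \<B>'"
    and f: "down_link f \<B> \<B>'" and B: "kite_graph a b c d \<in> \<B>"
  shows "c \<in> V'"
proof (rule ccontr)
  assume "c \<notin> V'"
  then have "edges (f (kite_graph a b c d)) \<subseteq> {{a, b}}"
    using down_link_block(3)[OF \<B> \<B>' f B] by auto
  then have "card (edges (f (kite_graph a b c d))) \<le> card {{a, b}}" by (intro card_mono) auto
  then show False using down_link_block(4)[OF \<B> \<B>' f B] by simp
qed

section \<open>Cyclic kite designs\<close>

text \<open>This is addition modulo \<open>m\<close> for \<open>x < m\<close> and
  \<open>j \<le> m\<close>. A single conditional subtraction keeps the facts about it within linear
  arithmetic.\<close>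

definition rot :: "nat \<Rightarrow> nat \<Rightarrow> nat \<Rightarrow> nat" where
  "rot m x j = (if x + j < m then x + j else x + j - m)"

lemma rot_less: "x < m \<Longrightarrow> j \<le> m \<Longrightarrow> rot m x j < m"
  by (auto simp: rot_def)

lemma rot_rot: "x < m \<Longrightarrow> i + j \<le> m \<Longrightarrow> rot m (rot m x i) j = rot m x (i + j)"
  by (auto simp: rot_def)

lemma rot_eq_iff: "x < m \<Longrightarrow> i < m \<Longrightarrow> j < m \<Longrightarrow> rot m x i = rot m x j \<longleftrightarrow> i = j"
  by (auto simp: rot_def)

lemma rot_fixed_iff: "x < m \<Longrightarrow> j < m \<Longrightarrow> rot m x j = x \<longleftrightarrow> j = 0" "x < m \<Longrightarrow> j < m \<Longrightarrow> x = rot m x j \<longleftrightarrow> j = 0"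
  by (auto simp: rot_def)

lemma distinct_rot:
  assumes "x < m" "i < m" "j < m" "l < m" "distinct [i, j, 0, l]"
  shows "distinct [rot m x i, rot m x j, x, rot m x l]"
    "{rot m x i, rot m x j, x, rot m x l} \<subseteq> {..<m}"
  using assms by (simp_all add: rot_eq_iff rot_fixed_iff rot_less)

text \<open>The triangles \<open>{x, x + 2k - 1, x + s + k}\<close> use up the odd differences below \<open>2t\<close> and the
  differences in \<open>{s - t + 1..s + t}\<close>; the even differences up to \<open>s - t\<close> are left for the
  pendant edges. Used with \<open>s = 3t\<close> (\<open>m = 8t + 1\<close>) and \<open>s = 3t - 1\<close> (\<open>m = 8t - 1\<close>).\<close>

lemma rot_triangle_cover:
  assumes m: "m = 2 * s + 2 * t + 1" and s: "2 * t \<le> s" "s \<le> 3 * t"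
    and pq: "p < m" "q < m" "p \<noteq> q"
  obtains (fst) x k where "x < m" "k \<in> {1..t}" "{p, q} = {x, rot m x (2 * k - 1)}"
    | (snd) x k where "x < m" "k \<in> {1..t}" "{p, q} = {x, rot m x (s + k)}"
    | (opp) x k where "x < m" "k \<in> {1..t}" "{p, q} = {rot m x (2 * k - 1), rot m x (s + k)}"
    | (pend) x k where "x < m" "k \<in> {1..t}" "2 * k \<le> s - t" "{p, q} = {x, rot m x (2 * k)}"
proof -
  have dist: "\<exists>u D. u < m \<and> 1 \<le> D \<and> D \<le> s + t \<and> {p, q} = {u, rot m u D}"
    if "p < q" "q < m" for p q
  proof (cases "q - p \<le> s + t")
    case True
    then show ?thesis using that by (intro exI[of _ p] exI[of _ "q - p"]) (auto simp: rot_def)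
  next
    case False
    \<comment> \<open>Going round the cycle the other way, from \<open>q\<close> to
      \<open>p\<close>, has length \<open>m - (q - p)\<close>, which is at most \<open>s + t\<close>
      because m = 2(s + t) + 1.\<close>
    then show ?thesis using that m
      by (intro exI[of _ q] exI[of _ "m + p - q"]) (auto simp: rot_def)
  qed
  have "\<exists>u D. u < m \<and> 1 \<le> D \<and> D \<le> s + t \<and> {p, q} = {u, rot m u D}"
    using dist[of p q] dist[of q p] pq by (cases "p < q") (auto simp: insert_commute)
  then obtain u D where u: "u < m" "1 \<le> D" "D \<le> s + t" "{p, q} = {u, rot m u D}" by blast
  consider "D > s" | "s - t < D" "D \<le> s" | "D \<le> s - t" "odd D" | "D \<le> s - t" "even D" by linarith
  then show thesis
  proof cases
    case 1
    then show thesis using u by (intro snd[of u "D - s"]) auto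
  next
    case 2
    define k where "k = s + 1 - D"
    \<comment> \<open>\<open>x\<close> is u - (2k - 1) modulo \<open>m\<close>, so that
      \<open>u\<close> and u + D are the vertices x + 2k - 1 and x + s + k of one triangle.\<close>
    define x where "x = (if 2 * k - 1 \<le> u then u - (2 * k - 1) else u + m - (2 * k - 1))"
    have k: "1 \<le> k" "k \<le> t" "2 * k - 1 + D = s + k" using 2 s by (simp_all add: k_def)
    then have lt: "2 * k - 1 < m" "s + k \<le> m" using m s by simp_all
    then have x: "x < m" "rot m x (2 * k - 1) = u" using u(1) by (auto simp: x_def rot_def)
    moreover have "rot m x (s + k) = rot m u D"
      using rot_rot[of x m "2 * k - 1" D] x lt(2) k(3) by simp
    ultimately show thesis using u k by (intro opp[of x k]) auto
  next
    case 3
    then obtain k where k: "D = 2 * k + 1" by (elim oddE)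
    then show thesis using u 3 s by (intro fst[of u "k + 1"]) auto
  next
    case 4
    then obtain k where k: "D = 2 * k" by (elim evenE)
    then show thesis using u 4 s by (intro pend[of u k]) auto
  qed
qed

text \<open>The constructions compute with residues as natural numbers; an injection
  \<open>h\<close> carries them to the arbitrary infinite vertex type.\<close>

lemma kite_graph_image:
  assumes "inj h" "distinct [a, b, c, d]" "{a, b, c, d} \<subseteq> W"
  shows "\<exists>a' b' c' d'. distinct [a', b', c', d'] \<and> {a', b', c', d'} \<subseteq> h ` W \<and>
    kite_graph (h a) (h b) (h c) (h d) = kite_graph a' b' c' d'"
  using assms
  by (intro exI[of _ "h a"] exI[of _ "h b"] exI[of _ "h c"] exI[of _ "h d"]) (simp add: inj_eq)

text \<open>The base kites, for k = 1, ..., t, have centre 0, triangle {0, 2k - 1, 3t + k} and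
  pendant vertex 2k; modulo 8t + 1 they use each difference 1, ..., 4t once. Translation makes every
  vertex a centre, which is what \<open>not_down_linkable_pred\<close> needs.\<close>

lemma cyclic_kite_design:
  assumes t: "t \<ge> 1"
  shows "\<exists>(V :: 'a::infinite set) \<B>. finite V \<and> card V = 8 * t + 1 \<and> design (complete_graph V) kite \<B> \<and>
    (\<forall>c \<in> V. \<exists>a b d. kite_graph a b c d \<in> \<B>)"
proof -
  obtain h :: "nat \<Rightarrow> 'a" where h: "inj h"
    using infinite_countable_subset[OF infinite_UNIV[where 'a = 'a]] by blast
  define m where "m = 8 * t + 1"
  define V where "V = h ` {..<m}"
  define I where "I = {..<m} \<times> {1..t}"
  define K where "K = (\<lambda>(x, k). kite_graph (h (rot m x (2 * k - 1))) (h (rot m x (3 * t + k)))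
    (h x) (h (rot m x (2 * k))))"
  have card: "card V = m" using h by (simp add: V_def card_image inj_on_subset)
  have "design (complete_graph V) kite (K ` I)"
  proof (rule kite_family_design)
    show "finite V" "finite I" by (simp_all add: V_def I_def)
    show "4 * card I \<le> card V choose 2"
      unfolding card by (simp add: I_def m_def choose_two algebra_simps)
  next
    fix i assume "i \<in> I"
    then obtain x k where i: "i = (x, k)" "x < m" "1 \<le> k" "k \<le> t" by (auto simp: I_def)
    then have lt: "2 * k - 1 < m" "3 * t + k < m" "2 * k < m" "distinct [2 * k - 1, 3 * t + k, 0, 2 * k]"
      by (auto simp: m_def)
    from kite_graph_image[OF h distinct_rot[OF i(2) lt]]
    show "\<exists>a b c d. distinct [a, b, c, d] \<and> {a, b, c, d} \<subseteq> V \<and> K i = kite_graph a b c d"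
      by (simp only: K_def V_def i(1) prod.case)
  next
    fix e assume "e \<in> all_edges V"
    then obtain p q where pq: "e = h ` {p, q}" "p < m" "q < m" "p \<noteq> q"
      by (auto simp: V_def elim!: all_edgesE)
    have m: "m = 2 * (3 * t) + 2 * t + 1" "2 * t \<le> 3 * t" "3 * t \<le> 3 * t" by (simp_all add: m_def)
    from m pq(2-4) show "\<exists>i \<in> I. e \<in> edges (K i)"
    proof (cases rule: rot_triangle_cover)
      case (fst x k)
      then show ?thesis using pq(1) by (intro bexI[of _ "(x, k)"]) (simp_all add: K_def I_def)
    next
      case (snd x k)
      then show ?thesis using pq(1) by (intro bexI[of _ "(x, k)"]) (simp_all add: K_def I_def)
    next
      case (opp x k)
      then show ?thesis using pq(1) by (intro bexI[of _ "(x, k)"]) (simp_all add: K_def I_def)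
    next
      case (pend x k)
      then show ?thesis using pq(1) by (intro bexI[of _ "(x, k)"]) (simp_all add: K_def I_def)
    qed
  qed
  moreover have "\<exists>a b d. kite_graph a b c d \<in> K ` I" if c: "c \<in> V" for c
  proof -
    obtain x where x: "x < m" "c = h x" using c by (auto simp: V_def)
    then have "(x, 1) \<in> I" using t by (simp add: I_def)
    then have "K (x, 1) \<in> K ` I" by (rule imageI)
    moreover have "K (x, 1) = kite_graph (h (rot m x 1)) (h (rot m x (3 * t + 1))) c (h (rot m x 2))"
      by (simp add: K_def x(2))
    ultimately show ?thesis by metis
  qed
  ultimately show ?thesis using card by (intro exI[of _ V] exI[of _ "K ` I"]) (simp add: V_def m_def)
qed

text \<open>The cyclic group of order \<open>8t - 1\<close> with a fixed point, represented by \<open>8t - 1\<close>.\<close>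

lemma one_rotational_kite_design:
  assumes t: "t \<ge> 1"
  shows "\<exists>\<B> :: 'a::infinite graph set. design_of_order (8 * t) kite \<B>"
proof -
  obtain h :: "nat \<Rightarrow> 'a" where h: "inj h"
    using infinite_countable_subset[OF infinite_UNIV[where 'a = 'a]] by blast
  define m where "m = 8 * t - 1"
  define s where "s = 3 * t - 1"
  define V where "V = h ` {..m}"
  define I where "I = {..<m} \<times> {1..t}"
  \<comment> \<open>The even differences left for pendant edges are 2, ..., 2t - 2, one too few for
    \<open>t\<close> base blocks; the blocks with \<open>k = t\<close> therefore have the fixed
    point \<open>m\<close> as pendant vertex.\<close>
  define d where "d x k = (if k = t then m else rot m x (2 * k))" for x k
  define K where "K = (\<lambda>(x, k). kite_graph (h (rot m x (2 * k - 1))) (h (rot m x (s + k)))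
    (h x) (h (d x k)))"
  have m: "m = 2 * s + 2 * t + 1" "Suc m = 8 * t" using t by (simp_all add: m_def s_def)
  have card: "card V = 8 * t" using h m by (simp add: V_def card_image inj_on_subset)
  have "design (complete_graph V) kite (K ` I)"
  proof (rule kite_family_design)
    show "finite V" "finite I" by (simp_all add: V_def I_def)
    have "card V choose 2 = 8 * t * m div 2" unfolding card by (simp add: choose_two m_def)
    then show "4 * card I \<le> card V choose 2" by (simp add: I_def)
  next
    fix i assume "i \<in> I"
    then obtain x k where i: "i = (x, k)" "x < m" "1 \<le> k" "k \<le> t" by (auto simp: I_def)
    then have lt: "2 * k - 1 < m" "s + k < m" "2 * k < m" "distinct [2 * k - 1, s + k, 0, 2 * k]"
      using t by (auto simp: m_def s_def)
    have "distinct [rot m x (2 * k - 1), rot m x (s + k), x, d x k]"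
      "{rot m x (2 * k - 1), rot m x (s + k), x, d x k} \<subseteq> {..m}"
      using distinct_rot[OF i(2) lt] by (auto simp: d_def)
    from kite_graph_image[OF h this]
    show "\<exists>a b c d. distinct [a, b, c, d] \<and> {a, b, c, d} \<subseteq> V \<and> K i = kite_graph a b c d"
      by (simp only: K_def V_def i(1) prod.case)
  next
    fix e assume "e \<in> all_edges V"
    then obtain p q where pq: "e = h ` {p, q}" "p \<le> m" "q \<le> m" "p \<noteq> q"
      by (auto simp: V_def elim!: all_edgesE)
    have *: "\<exists>i \<in> I. h ` {x, m} \<in> edges (K i)" if "x < m" for x
      using that t by (intro bexI[of _ "(x, t)"]) (auto simp: K_def I_def d_def)
    consider "p = m" "q < m" | "q = m" "p < m" | "p < m" "q < m" using pq by linarith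
    then show "\<exists>i \<in> I. e \<in> edges (K i)"
    proof cases
      case 1
      then show ?thesis using *[of q] pq by (simp add: insert_commute)
    next
      case 2
      then show ?thesis using *[of p] pq by simp
    next
      case 3
      have "2 * t \<le> s" "s \<le> 3 * t" using t by (simp_all add: s_def)
      from m(1) this 3 pq(4) show ?thesis
      proof (cases rule: rot_triangle_cover)
        case (fst x k)
        then show ?thesis using pq(1) by (intro bexI[of _ "(x, k)"]) (simp_all add: K_def I_def)
      next
        case (snd x k)
        then show ?thesis using pq(1) by (intro bexI[of _ "(x, k)"]) (simp_all add: K_def I_def)
      next
        case (opp x k)
        then show ?thesis using pq(1) by (intro bexI[of _ "(x, k)"]) (simp_all add: K_def I_def)
      next
        case (pend x k)
        then have "k \<noteq> t" using t unfolding s_def by linarith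
        with pend show ?thesis using pq(1)
          by (intro bexI[of _ "(x, k)"]) (simp_all add: K_def I_def d_def)
      qed
    qed
  qed
  then show ?thesis
    using card unfolding design_of_order_def by (intro exI[of _ "K ` I"] exI[of _ V]) (simp add: V_def)
qed

text \<open>The blocks (0, i), (2i - 1, 1) and (2i, t + 1 - i) will exchange pendant edges;
  \<open>default\<close> collects the blocks that keep theirs.\<close>

lemma non_centre_index_cases:
  assumes "1 \<le> (k :: nat)" "k \<le> t"
  obtains (zero) "x = 0"
    | (odd) i where "1 \<le> i" "i \<le> t" "x = 2 * i - 1" "k = 1"
    | (even) i where "1 \<le> i" "i \<le> t" "x = 2 * i" "k = t + 1 - i"
    | (default) "x \<noteq> 0" "\<not> (odd x \<and> x < 2 * t \<and> k = 1)"
        "\<not> (even x \<and> x \<le> 2 * t \<and> k = t + 1 - x div 2)"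
proof -
  consider "x = 0" | "odd x" "x < 2 * t" "k = 1" | "x \<noteq> 0" "even x" "x \<le> 2 * t" "k = t + 1 - x div 2"
    | "x \<noteq> 0" "\<not> (odd x \<and> x < 2 * t \<and> k = 1)" "\<not> (even x \<and> x \<le> 2 * t \<and> k = t + 1 - x div 2)"
    by blast
  then show thesis
  proof cases
    case 1
    then show thesis by (rule zero)
  next
    case 2
    then obtain j where "x = 2 * j + 1" by (elim oddE)
    then show thesis using 2 by (intro odd[of "j + 1"]) auto
  next
    case 3
    then obtain i where "x = 2 * i" by (elim evenE)
    then show thesis using 3 by (intro even[of i]) auto
  next
    case 4
    then show thesis by (rule default)
  qed
qed

text \<open>In the cyclic design the block \<open>(x, k)\<close> is the triangle \<open>{x, x + 2k - 1, x + 3t + k}\<close> with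
  the pendant edge \<open>{x, x + 2k}\<close>. Moving pendant edges along the 3-cycles
  \<open>(0, i) \<leftarrow> (2i - 1, 1) \<leftarrow> (2i, t + 1 - i) \<leftarrow> (0, i)\<close> of blocks, for \<open>1 \<le> i \<le> t\<close>, gives a design
  in which \<open>0\<close> is no longer a centre. After the deletion of \<open>0\<close>, the blocks in which \<open>0\<close> was
  pendant become triangles, each of which leaves an edge uncovered; they can be chosen to form
  two stars at \<open>2t + 1\<close> and at \<open>-1\<close> with the common leaf \<open>2t\<close>.\<close>

lemma non_centre_design_down_link:
  assumes t: "t \<ge> 1"
  shows "\<exists>\<B> :: 'a::infinite graph set. design_of_order (8 * t + 1) kite \<B> \<and>
    (\<exists>\<B>'. design_of_order (8 * t) path3 \<B>' \<and> down_linkable \<B> \<B>')"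
proof -
  obtain h :: "nat \<Rightarrow> 'a" where h: "inj h"
    using infinite_countable_subset[OF infinite_UNIV[where 'a = 'a]] by blast
  define m where "m = 8 * t + 1"
  define V where "V = h ` {..<m}"
  define I where "I = {..<m} \<times> {1..t}"
  \<comment> \<open>Every clause keeps the triangle of the cyclic block. In the first clause the
    centre moves from 0 to 2k - 1, in the second from x to x + 1, and in the third it stays at x, in
    each case to an end of the pendant edge that is received.\<close>
  define K where "K = (\<lambda>(x, k).
    if x = 0 then kite_graph (h 0) (h (3 * t + k)) (h (2 * k - 1)) (h (2 * k + 1))
    else if odd x \<and> x < 2 * t \<and> k = 1
    then kite_graph (h x) (h (3 * t + 1 + x)) (h (x + 1)) (h (2 * t + 2))
    else if even x \<and> x \<le> 2 * t \<and> k = t + 1 - x div 2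
    then kite_graph (h (2 * t + 1)) (h (3 * t + k + x)) (h x) (h 0)
    else kite_graph (h (rot m x (2 * k - 1))) (h (rot m x (3 * t + k))) (h x) (h (rot m x (2 * k))))"
  \<comment> \<open>\<open>J\<close> indexes the blocks with pendant vertex 0: the first family
    acquires it in the exchange, the second has x + 2j = m and had it in the cyclic design.\<close>
  define J where "J = (\<lambda>i. (2 * i, t + 1 - i)) ` {1..t} \<union> (\<lambda>j. (8 * t + 1 - 2 * j, j)) ` {1..t}"
  \<comment> \<open>The edge given up is a side at the centre in the first family of
    \<open>J\<close> and the side opposite the centre in the second. The test
    \<open>x \<le> 2 * t\<close> separates the families because 8t + 1 - 2j exceeds 2t.\<close>
  define l where "l = (\<lambda>(x, k). if x \<le> 2 * t then {h x, h (2 * t + 1)} else {h (8 * t), h (3 * t - k)})"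
  have K0: "K (0, i) = kite_graph (h 0) (h (3 * t + i)) (h (2 * i - 1)) (h (2 * i + 1))" for i
    by (simp add: K_def)
  have K1: "K (2 * i - 1, 1) = kite_graph (h (2 * i - 1)) (h (3 * t + 2 * i)) (h (2 * i)) (h (2 * t + 2))"
    if "1 \<le> i" "i \<le> t" for i
  proof -
    have "odd (2 * i - 1)" "2 * i - 1 < 2 * t" "2 * i - 1 \<noteq> 0" "3 * t + 1 + (2 * i - 1) = 3 * t + 2 * i"
      "2 * i - 1 + 1 = 2 * i"
      using that by auto
    then show ?thesis unfolding K_def by (simp del: One_nat_def)
  qed
  have K2: "K (2 * i, t + 1 - i) = kite_graph (h (2 * t + 1)) (h (4 * t + 1 + i)) (h (2 * i)) (h 0)"
    if "1 \<le> i" "i \<le> t" for i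
  proof -
    have "3 * t + (t + 1 - i) + 2 * i = 4 * t + 1 + i" using that by simp
    then show ?thesis using that unfolding K_def by (simp add: add.commute)
  qed
  have K3: "K (x, k) = kite_graph (h (rot m x (2 * k - 1))) (h (rot m x (3 * t + k))) (h x) (h (rot m x (2 * k)))"
    if "x \<noteq> 0" "\<not> (odd x \<and> x < 2 * t \<and> k = 1)" "\<not> (even x \<and> x \<le> 2 * t \<and> k = t + 1 - x div 2)" for x k
    using that unfolding K_def by auto
  have J_cases: "(\<exists>i. 1 \<le> i \<and> i \<le> t \<and> x = 2 * i \<and> k = t + 1 - i) \<or> (1 \<le> k \<and> k \<le> t \<and> x + 2 * k = m)"
    if "(x, k) \<in> J" for x k
    using that by (auto simp: J_def m_def)
  have J_I: "J \<subseteq> I" by (auto simp: J_def I_def m_def)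
  have blocks: "\<exists>a b c d. K i = kite_graph (h a) (h b) (h c) (h d) \<and> distinct [a, b, c, d] \<and>
      {a, b, c, d} \<subseteq> {..<m} \<and> c \<noteq> 0 \<and> (d = 0 \<longleftrightarrow> i \<in> J) \<and>
      (d = 0 \<longrightarrow> l i \<in> {{h c, h a}, {h c, h b}, {h a, h b}})"
    if iI: "i \<in> I" for i
  proof -
    obtain x k where i: "i = (x, k)" "x < m" "1 \<le> k" "k \<le> t" using iI by (auto simp: I_def)
    have block: ?thesis
      if "K i = kite_graph (h a) (h b) (h c) (h d)" "distinct [a, b, c, d]" "{a, b, c, d} \<subseteq> {..<m}"
        "c \<noteq> 0" "d = 0 \<longleftrightarrow> i \<in> J" "d = 0 \<longrightarrow> l i \<in> {{h c, h a}, {h c, h b}, {h a, h b}}" for a b c d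
      using that by blast
    from i(3,4) show ?thesis
    proof (cases rule: non_centre_index_cases[where x = x])
      case zero
      have "i \<notin> J" using J_cases[of x k] zero i by (auto simp: m_def)
      show ?thesis
      proof (rule block)
        show "K i = kite_graph (h 0) (h (3 * t + k)) (h (2 * k - 1)) (h (2 * k + 1))"
          unfolding i(1) zero by (rule K0)
        show "distinct [0, 3 * t + k, 2 * k - 1, 2 * k + 1]"
          "{0, 3 * t + k, 2 * k - 1, 2 * k + 1} \<subseteq> {..<m}" "2 * k - 1 \<noteq> 0"
          using i(3,4) by (auto simp: m_def)
      qed (use \<open>i \<notin> J\<close> in simp_all)
    next
      case (odd j)
      have "i \<notin> J"
      proof
        assume "i \<in> J"
        then have "(x, k) \<in> J" by (simp add: i(1))
        from J_cases[OF this] have "even x \<or> x + 2 * k = m" by auto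
        moreover have "odd x" "x + 2 * k < m" using odd by (simp_all add: m_def)
        ultimately show False by simp
      qed
      show ?thesis
      proof (rule block)
        show "K i = kite_graph (h (2 * j - 1)) (h (3 * t + 2 * j)) (h (2 * j)) (h (2 * t + 2))"
          unfolding i(1) odd(3,4) by (rule K1[OF odd(1,2)])
        show "distinct [2 * j - 1, 3 * t + 2 * j, 2 * j, 2 * t + 2]"
          "{2 * j - 1, 3 * t + 2 * j, 2 * j, 2 * t + 2} \<subseteq> {..<m}" "2 * j \<noteq> 0"
          using odd(1,2) by (auto simp: m_def)
      qed (use \<open>i \<notin> J\<close> in simp_all)
    next
      case (even j)
      have J: "i \<in> J" unfolding i(1) J_def using even by auto
      show ?thesis
      proof (rule block)
        show "K i = kite_graph (h (2 * t + 1)) (h (4 * t + 1 + j)) (h (2 * j)) (h 0)"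
          unfolding i(1) even(3,4) by (rule K2[OF even(1,2)])
        show "distinct [2 * t + 1, 4 * t + 1 + j, 2 * j, 0]"
          "{2 * t + 1, 4 * t + 1 + j, 2 * j, 0} \<subseteq> {..<m}" "2 * j \<noteq> 0"
          using even(1,2) by (auto simp: m_def)
        show "0 = (0 :: nat) \<longleftrightarrow> i \<in> J" using J by simp
        have "l i = {h (2 * j), h (2 * t + 1)}" unfolding i(1) even(3) l_def using even(2) by simp
        then show "0 = (0 :: nat) \<longrightarrow> l i \<in> {{h (2 * j), h (2 * t + 1)},
            {h (2 * j), h (4 * t + 1 + j)}, {h (2 * t + 1), h (4 * t + 1 + j)}}"
          by (simp only: insertI1 simp_thms)
      qed
    next
      case default
      let ?a = "rot m x (2 * k - 1)" and ?b = "rot m x (3 * t + k)" and ?d = "rot m x (2 * k)"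
      have z: "?d = 0 \<longleftrightarrow> x + 2 * k = m" using default(1) i by (auto simp: rot_def m_def)
      have "(x, k) \<notin> (\<lambda>i. (2 * i, t + 1 - i)) ` {1..t}" using default by auto
      moreover have "(x, k) \<in> (\<lambda>j. (8 * t + 1 - 2 * j, j)) ` {1..t} \<longleftrightarrow> x + 2 * k = m"
        using i by (auto simp: m_def image_iff)
      ultimately have J: "i \<in> J \<longleftrightarrow> x + 2 * k = m" unfolding i(1) J_def by blast
      show ?thesis
      proof (rule block)
        show "K i = kite_graph (h ?a) (h ?b) (h x) (h ?d)"
          unfolding i(1) by (rule K3[OF default])
        have lt: "2 * k - 1 < m" "3 * t + k < m" "2 * k < m" "distinct [2 * k - 1, 3 * t + k, 0, 2 * k]"
          using i(3,4) by (auto simp: m_def)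
        show "distinct [?a, ?b, x, ?d]" "{?a, ?b, x, ?d} \<subseteq> {..<m}"
          by (rule distinct_rot[OF i(2) lt])+
        show "x \<noteq> 0" by (rule default(1))
        show "?d = 0 \<longleftrightarrow> i \<in> J" using z J by simp
        show "?d = 0 \<longrightarrow> l i \<in> {{h x, h ?a}, {h x, h ?b}, {h ?a, h ?b}}"
        proof
          assume "?d = 0"
          then have "x + 2 * k = m" using z by simp
          then have "?a = 8 * t" "?b = 3 * t - k" "\<not> x \<le> 2 * t"
            using i by (auto simp: rot_def m_def)
          then have "l i = {h ?a, h ?b}" unfolding i(1) l_def by simp
          then show "l i \<in> {{h x, h ?a}, {h x, h ?b}, {h ?a, h ?b}}" by blast
        qed
      qed
    qed
  qed
  \<comment> \<open>Although some centres have moved, the triangle sides lie in the same blocks as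
    in the cyclic design.\<close>
  have triangle: "h ` {x, rot m x (2 * k - 1)} \<in> edges (K (x, k)) \<and>
      h ` {x, rot m x (3 * t + k)} \<in> edges (K (x, k)) \<and>
      h ` {rot m x (2 * k - 1), rot m x (3 * t + k)} \<in> edges (K (x, k))"
    if xk: "x < m" "1 \<le> k" "k \<le> t" for x k
    using xk(2,3)
  proof (cases rule: non_centre_index_cases[where x = x])
    case zero
    have "rot m 0 (2 * k - 1) = 2 * k - 1" "rot m 0 (3 * t + k) = 3 * t + k"
      using xk by (auto simp: rot_def m_def)
    then show ?thesis
      unfolding zero K0 by (simp add: insert_commute)
  next
    case (odd i)
    have "rot m (2 * i - 1) (2 * 1 - 1) = 2 * i" "rot m (2 * i - 1) (3 * t + 1) = 3 * t + 2 * i"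
      using odd by (auto simp: rot_def m_def)
    then show ?thesis
      unfolding odd(3,4) K1[OF odd(1,2)] by (simp add: insert_commute)
  next
    case (even i)
    have "rot m (2 * i) (2 * (t + 1 - i) - 1) = 2 * t + 1" "rot m (2 * i) (3 * t + (t + 1 - i)) = 4 * t + 1 + i"
      using even by (auto simp: rot_def m_def)
    then show ?thesis
      unfolding even(3,4) K2[OF even(1,2)] by (simp add: insert_commute)
  next
    case default
    show ?thesis
      unfolding K3[OF default] by simp
  qed
  \<comment> \<open>The pendant edge of (0, k) is now in (2k, t + 1 - k), that of (2i - 1, 1) in (0,
    i), and that of (2i, t + 1 - i) in (2i - 1, 1).\<close>
  have pendant: "\<exists>i \<in> I. h ` {x, rot m x (2 * k)} \<in> edges (K i)" if xk: "x < m" "1 \<le> k" "k \<le> t" for x k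
    using xk(2,3)
  proof (cases rule: non_centre_index_cases[where x = x])
    case zero
    have "rot m 0 (2 * k) = 2 * k" using xk by (auto simp: rot_def m_def)
    then have "h ` {x, rot m x (2 * k)} \<in> edges (K (2 * k, t + 1 - k))"
      unfolding zero K2[OF xk(2,3)] by (simp add: insert_commute)
    then show ?thesis by (rule bexI) (use xk in \<open>auto simp: I_def m_def\<close>)
  next
    case (odd i)
    have "rot m (2 * i - 1) (2 * 1) = 2 * i + 1" using odd by (auto simp: rot_def m_def)
    then have "h ` {x, rot m x (2 * k)} \<in> edges (K (0, i))"
      unfolding odd(3,4) K0 by simp
    then show ?thesis by (rule bexI) (use odd in \<open>auto simp: I_def m_def\<close>)
  next
    case (even i)
    have "rot m (2 * i) (2 * (t + 1 - i)) = 2 * t + 2" using even by (auto simp: rot_def m_def)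
    then have "h ` {x, rot m x (2 * k)} \<in> edges (K (2 * i - 1, 1))"
      unfolding even(3,4) K1[OF even(1,2)] by simp
    then show ?thesis by (rule bexI) (use even in \<open>auto simp: I_def m_def\<close>)
  next
    case default
    have "h ` {x, rot m x (2 * k)} \<in> edges (K (x, k))" unfolding K3[OF default] by simp
    then show ?thesis by (rule bexI) (use xk in \<open>auto simp: I_def\<close>)
  qed
  have card: "card V = m" using h by (simp add: V_def card_image inj_on_subset)
  have kites: "\<exists>a b c d. distinct [a, b, c, d] \<and> {a, b, c, d} \<subseteq> V \<and> K i = kite_graph a b c d"
    if i: "i \<in> I" for i
  proof -
    obtain a b c d where k: "K i = kite_graph (h a) (h b) (h c) (h d)" "distinct [a, b, c, d]"
      "{a, b, c, d} \<subseteq> {..<m}"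
      using blocks[OF i] by blast
    show ?thesis unfolding k(1) V_def by (rule kite_graph_image[OF h k(2,3)])
  qed
  have cover: "\<exists>i \<in> I. e \<in> edges (K i)" if e: "e \<in> all_edges V" for e
  proof -
    obtain p q where pq: "e = h ` {p, q}" "p < m" "q < m" "p \<noteq> q"
      using e by (auto simp: V_def elim!: all_edgesE)
    have m: "m = 2 * (3 * t) + 2 * t + 1" "2 * t \<le> 3 * t" "3 * t \<le> 3 * t" by (simp_all add: m_def)
    from m pq(2-4) show ?thesis
    proof (cases rule: rot_triangle_cover)
      case (fst x k)
      then show ?thesis unfolding pq(1) fst(3)
        using triangle[of x k] by (intro bexI[of _ "(x, k)"]) (simp_all add: I_def)
    next
      case (snd x k)
      then show ?thesis unfolding pq(1) snd(3)
        using triangle[of x k] by (intro bexI[of _ "(x, k)"]) (simp_all add: I_def)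
    next
      case (opp x k)
      then show ?thesis unfolding pq(1) opp(3)
        using triangle[of x k] by (intro bexI[of _ "(x, k)"]) (simp_all add: I_def)
    next
      case (pend x k)
      then show ?thesis unfolding pq(1) pend(4) using pendant[of x k] by simp
    qed
  qed
  have fin: "finite V" "finite I" by (simp_all add: V_def I_def)
  have count: "4 * card I \<le> card V choose 2"
    unfolding card by (simp add: I_def m_def choose_two algebra_simps)
  note design = kite_family_design[OF fin kites cover count]
  define L where "L = l ` J"
  have l_edge: "l i \<in> edges (K i)" if iJ: "i \<in> J" for i
  proof -
    obtain a b c d where "K i = kite_graph (h a) (h b) (h c) (h d)"
      "l i \<in> {{h c, h a}, {h c, h b}, {h a, h b}}"
      using blocks[of i] J_I iJ by blast
    then show ?thesis by (simp only: kite_graph_simps insert_iff) blast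
  qed
  have edges_L: "edges (K i) \<inter> L = (if i \<in> J then {l i} else {})" if "i \<in> I" for i
  proof -
    \<comment> \<open>Disjointness over indices, not merely over the set of blocks, recovers the
      index of the block containing an edge.\<close>
    have "j = i" if "j \<in> J" "l j \<in> edges (K i)" for j
    proof (rule ccontr)
      assume "j \<noteq> i"
      then have "edges (K j) \<inter> edges (K i) = {}"
        using design(1) \<open>i \<in> I\<close> J_I that(1) unfolding disjoint_family_on_def by blast
      then show False using l_edge[OF that(1)] that(2) by blast
    qed
    then show ?thesis using l_edge[of i] unfolding L_def by auto
  qed
  have L_cases: "(\<exists>i. 1 \<le> i \<and> i \<le> t \<and> e = {h (2 * i), h (2 * t + 1)}) \<or>
      (\<exists>j. 1 \<le> j \<and> j \<le> t \<and> e = {h (8 * t), h (3 * t - j)})" if "e \<in> L" for e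
    using that by (auto simp: L_def J_def l_def split: if_splits)
  \<comment> \<open>Taking i = t in one star and j = t in the other gives the common leaf 2t, since
    3t - t = 2t; it is the dominating vertex for \<open>L\<close>.\<close>
  have hub: "{h (2 * t + 1), h (2 * t)} \<in> L" "{h (8 * t), h (2 * t)} \<in> L"
  proof -
    have "(2 * t, 1) \<in> J" "(8 * t + 1 - 2 * t, t) \<in> J" using t by (auto simp: J_def image_iff)
    then have "l (2 * t, 1) \<in> L" "l (8 * t + 1 - 2 * t, t) \<in> L" by (simp_all add: L_def)
    then show "{h (2 * t + 1), h (2 * t)} \<in> L" "{h (8 * t), h (2 * t)} \<in> L"
      using t by (simp_all add: l_def insert_commute)
  qed
  have card': "card (V - {h 0}) = 8 * t" using card fin t by (simp add: V_def m_def)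
  have "\<exists>\<B>'. design_of_order (card (V - {h 0})) path3 \<B>' \<and> down_linkable (K ` I) \<B>'"
  proof (rule down_link_leftover[OF design(2)])
    show "finite (V - {h 0})" using fin by simp
    show "even (card (V - {h 0}) choose 2)"
      unfolding card' even_choose_2_iff by (simp add: cong_0_iff)
    show "all_edges (V - {h 0}) - all_edges V \<subseteq> L" by (auto simp: all_edges_def)
    show "L \<subseteq> all_edges (V - {h 0})"
    proof
      fix e assume "e \<in> L"
      from L_cases[OF this] show "e \<in> all_edges (V - {h 0})"
        using h t by (auto simp: V_def m_def inj_eq)
    qed
  next
    fix B assume "B \<in> K ` I"
    then obtain i where i: "i \<in> I" "B = K i" by blast
    obtain a b c d where k: "K i = kite_graph (h a) (h b) (h c) (h d)" "distinct [a, b, c, d]"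
      "{a, b, c, d} \<subseteq> {..<m}" "c \<noteq> 0" "d = 0 \<longleftrightarrow> i \<in> J"
      "d = 0 \<longrightarrow> l i \<in> {{h c, h a}, {h c, h b}, {h a, h b}}"
      using blocks[OF i(1)] by blast
    show "\<exists>Q. Q \<noteq> {} \<and> p3_partition (edges B \<inter> all_edges (V - {h 0}) - L) Q"
      unfolding i(2) k(1)
    proof (rule p3_partition_kite_minus_vertex)
      show "distinct [h a, h b, h c, h d]" using k(2) h by (simp add: inj_eq)
      show "{h a, h b, h c, h d} \<subseteq> V" using k(3) by (simp add: V_def)
      show "h 0 \<noteq> h c" using k(4) h by (simp add: inj_eq)
      show "edges (kite_graph (h a) (h b) (h c) (h d)) \<inter> L = {}" if "h d \<noteq> h 0"
        using edges_L[OF i(1)] k(5) that unfolding k(1) by metis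
      show "\<exists>e \<in> {{h c, h a}, {h c, h b}, {h a, h b}}.
          edges (kite_graph (h a) (h b) (h c) (h d)) \<inter> L = {e}" if "h d = h 0"
      proof
        have "d = 0" using that h by (simp add: inj_eq)
        then show "edges (kite_graph (h a) (h b) (h c) (h d)) \<inter> L = {l i}"
          using edges_L[OF i(1)] k(5) unfolding k(1) by metis
        show "l i \<in> {{h c, h a}, {h c, h b}, {h a, h b}}" using k(6) \<open>d = 0\<close> by blast
      qed
    qed
  next
    fix e assume e: "e \<in> L" "h (2 * t) \<notin> e"
    from L_cases[OF e(1)] show "\<exists>x \<in> e. {x, h (2 * t)} \<in> L" using hub by auto
  qed
  moreover have "design_of_order (8 * t + 1) kite (K ` I)"
    using design(2) card fin(1) unfolding design_of_order_def m_def by blast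
  ultimately show ?thesis unfolding card' by blast
qed

section \<open>The order spectra\<close>

lemma down_linkable_order:
  fixes \<B> :: "'a::infinite graph set"
  assumes \<B>: "design_of_order v kite \<B>" and \<B>': "design_of_order n path3 \<B>'"
    and lk: "down_linkable \<B> \<B>'"
  shows "v - 1 \<le> n \<and> ([n = 0] (mod 4) \<or> [n = 1] (mod 4))"
proof -
  obtain f where f: "down_link f \<B> \<B>'" using lk by (auto simp: down_linkable_def)
  obtain V where V: "finite V" "card V = v" "design (complete_graph V) kite \<B>"
    using \<B> by (auto simp: design_of_order_def)
  obtain V' where V': "finite V'" "card V' = n" "design (complete_graph V') path3 \<B>'"
    using \<B>' by (auto simp: design_of_order_def)
  show ?thesis
    using down_link_order_ge[OF V(3) V'(3) f V(1) V'(1)] design_path3_order[OF \<B>'] V(2) V'(2) by simp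
qed

lemma not_down_linkable_pred:
  assumes t: "t \<ge> 1"
  shows "\<exists>\<B> :: 'a::infinite graph set. design_of_order (8 * t + 1) kite \<B> \<and>
    \<not> (\<exists>\<B>'. design_of_order (8 * t) path3 \<B>' \<and> down_linkable \<B> \<B>')"
proof -
  obtain V :: "'a set" and \<B> where V: "finite V" "card V = 8 * t + 1" "design (complete_graph V) kite \<B>"
    and centre: "\<And>c. c \<in> V \<Longrightarrow> \<exists>a b d. kite_graph a b c d \<in> \<B>"
    using cyclic_kite_design[OF t, where 'a = 'a] by blast
  have False if \<B>': "design_of_order (8 * t) path3 \<B>'" "down_link f \<B> \<B>'" for \<B>' f
  proof -
    obtain V' where V': "finite V'" "card V' = 8 * t" "design (complete_graph V') path3 \<B>'"
      using \<B>'(1) unfolding design_of_order_def by blast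
    have "V \<subseteq> V'" using centre down_link_centre[OF V(3) V'(3) \<B>'(2)] by blast
    then show False using card_mono[OF V'(1), of V] V(2) V'(2) by simp
  qed
  then show ?thesis
    using V by (intro exI[of _ \<B>]) (auto simp: design_of_order_def down_linkable_def)
qed

theorem theorem6p4:
  fixes v :: nat
  assumes "[v = 0] (mod 8) \<or> [v = 1] (mod 8)" and "v > 1"
  shows "L1 TYPE('a::infinite) kite v = {n. n \<ge> v - 1 \<and> ([n = 0] (mod 4) \<or> [n = 1] (mod 4))} \<and>
         L2 TYPE('a::infinite) kite v = {n. n \<ge> v \<and> ([n = 0] (mod 4) \<or> [n = 1] (mod 4))}"
proof -
  obtain t where t: "t \<ge> 1" "v = 8 * t \<or> v = 8 * t + 1"
  proof -
    have "v mod 8 = 0 \<or> v mod 8 = 1" using assms(1) by (simp add: cong_def)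
    then have "v = 8 * (v div 8) \<or> v = 8 * (v div 8) + 1" by (metis add.right_neutral mult_div_mod_eq)
    moreover from this have "v div 8 \<ge> 1" using assms(2) by (cases "v div 8") auto
    ultimately show thesis using that by blast
  qed
  \<comment> \<open>Existence matters for both spectra: without a design of order \<open>v\<close>,
    the second one would contain every number.\<close>
  have ex: "\<exists>\<B> :: 'a graph set. design_of_order v kite \<B>"
    using t one_rotational_kite_design[OF t(1)] non_centre_design_down_link[OF t(1)] by blast
  have pred: "v = 8 * t + 1 \<and> n = 8 * t"
    if "v - 1 \<le> n" "\<not> v \<le> n" "[n = 0] (mod 4) \<or> [n = 1] (mod 4)" for n
  proof (rule ccontr)
    assume neg: "\<not> (v = 8 * t + 1 \<and> n = 8 * t)"
    \<comment> \<open>What remains is v = 8t with n = v - 1.\<close>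
    then have "n = 4 * (2 * t - 1) + 3" using that(1,2) t by auto
    then have "n mod 4 = 3" by (simp only: mod_mult_self4) simp
    then show False using that(3) by (simp add: cong_def)
  qed
  have ge: "\<exists>\<B>'. design_of_order n path3 \<B>' \<and> down_linkable \<B> \<B>'"
    if "design_of_order v kite \<B>" "v \<le> n" "[n = 0] (mod 4) \<or> [n = 1] (mod 4)"
    for n and \<B> :: "'a graph set"
    using kite_design_down_link[OF that(1) _ that(2)] that(3) assms(2) by (simp add: even_choose_2_iff)
  show ?thesis
  proof
    show "L1 TYPE('a::infinite) kite v = {n. n \<ge> v - 1 \<and> ([n = 0] (mod 4) \<or> [n = 1] (mod 4))}"
    proof (intro equalityI subsetI)
      fix n assume "n \<in> L1 TYPE('a) kite v"
      then show "n \<in> {n. n \<ge> v - 1 \<and> ([n = 0] (mod 4) \<or> [n = 1] (mod 4))}"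
        using down_linkable_order unfolding L1_def by blast
    next
      fix n assume "n \<in> {n. n \<ge> v - 1 \<and> ([n = 0] (mod 4) \<or> [n = 1] (mod 4))}"
      then have n: "n \<ge> v - 1" "[n = 0] (mod 4) \<or> [n = 1] (mod 4)" by auto
      show "n \<in> L1 TYPE('a) kite v"
      proof (cases "v \<le> n")
        case True
        then show ?thesis using ex ge n(2) unfolding L1_def by blast
      next
        case False
        then show ?thesis
          using pred[OF n(1) False n(2)] non_centre_design_down_link[OF t(1), where 'a = 'a]
          unfolding L1_def by blast
      qed
    qed
    show "L2 TYPE('a::infinite) kite v = {n. n \<ge> v \<and> ([n = 0] (mod 4) \<or> [n = 1] (mod 4))}"
    proof (intro equalityI subsetI)
      fix n assume n: "n \<in> L2 TYPE('a) kite v"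
      then have all: "\<exists>\<B>'. design_of_order n path3 \<B>' \<and> down_linkable \<B> \<B>'"
        if "design_of_order v kite \<B>" for \<B> :: "'a graph set"
        using that unfolding L2_def by blast
      have 1: "v - 1 \<le> n" "[n = 0] (mod 4) \<or> [n = 1] (mod 4)"
        using ex all down_linkable_order by blast+
      have "v \<le> n"
      proof (rule ccontr)
        assume "\<not> v \<le> n"
        then have "v = 8 * t + 1" "n = 8 * t" using pred[OF 1(1) _ 1(2)] by auto
        then show False using not_down_linkable_pred[OF t(1), where 'a = 'a] all by blast
      qed
      then show "n \<in> {n. n \<ge> v \<and> ([n = 0] (mod 4) \<or> [n = 1] (mod 4))}" using 1(2) by blast
    next
      fix n assume "n \<in> {n. n \<ge> v \<and> ([n = 0] (mod 4) \<or> [n = 1] (mod 4))}"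
      then show "n \<in> L2 TYPE('a) kite v" using ge unfolding L2_def by blast
    qed
  qed
qed

end
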